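(* Let $R\in\mathbb{R}^{n\times n}$ be invertible and let $x:\,]a,b[\,\to\mathbb{R}^n$ be differentiable. Then (i) $D^+\|x(t)\|_{1,R}=\operatorname{sign}(Rx(t))^\top R\dot x(t)$ for almost every $t\in\,]a,b[$; (ii) $\|x(t)\|_{1,R}\,D^+\|x(t)\|_{1,R}=[\![\dot x(t),x(t)]\!]_{1,R}$ for almost every $t\in\,]a,b[$.
   Context: $\|x\|_{1,R}=\|Rx\|_1$. $\operatorname{sign}:\mathbb{R}^n\to\{-1,0,1\}^n$ is the entrywise sign, with $\operatorname{sign}(0)=0$. The sign pairing is $[\![x,y]\!]_{1,R}=\|y\|_{1,R}\,\operatorname{sign}(Ry)^\top Rx$. $D^+\varphi(t)=\limsup_{h\to0^+}\frac{\varphi(t+h)-\varphi(t)}{h}$ is the upper right Dini derivative. *)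

theory Defs
  imports "HOL-Analysis.Analysis"
begin

definition l1_norm :: "real ^ 'n \<Rightarrow> real" where
  "l1_norm x = (\<Sum>i\<in>UNIV. \<bar>x $ i\<bar>)"

definition weighted_l1_norm :: "real ^ 'n ^ 'n \<Rightarrow> real ^ 'n \<Rightarrow> real" where
  "weighted_l1_norm R x = l1_norm (R *v x)"

text \<open>Entrywise sign. The library's \<open>sgn\<close> on vectors is the normalisation
  \<open>x /\<^sub>R norm x\<close>, so only its instance on \<open>real\<close> is used here.\<close>

definition sign_vec :: "real ^ 'n \<Rightarrow> real ^ 'n" where
  "sign_vec x = (\<chi> i. sgn (x $ i))"

definition sign_pairing :: "real ^ 'n ^ 'n \<Rightarrow> real ^ 'n \<Rightarrow> real ^ 'n \<Rightarrow> real" where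
  "sign_pairing R x y = weighted_l1_norm R y * (sign_vec (R *v y) \<bullet> (R *v x))"

text \<open>The limsup is taken in the extended reals, where it always exists.\<close>

definition upper_right_dini :: "(real \<Rightarrow> real) \<Rightarrow> real \<Rightarrow> ereal" where
  "upper_right_dini \<phi> t = Limsup (at_right 0) (\<lambda>h. ereal ((\<phi> (t + h) - \<phi> t) / h))"

end

theory Submission
  imports Defs
begin

text \<open>
  Each coordinate \<open>y\<^sub>i = (R x)\<^sub>i\<close> is a differentiable scalar function, and \<open>\<bar>y\<^sub>i\<bar>\<close> is
  differentiable with derivative \<open>sgn (y\<^sub>i) y\<^sub>i'\<close> except where \<open>y\<^sub>i\<close> has a transversal zero,
  that is where \<open>y\<^sub>i = 0\<close> and \<open>y\<^sub>i' \<noteq> 0\<close>; at a zero with \<open>y\<^sub>i' = 0\<close> both the derivative and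
  the sign formula give \<open>0\<close>. A transversal zero is isolated among all zeros of \<open>y\<^sub>i\<close>, because the
  difference quotients there tend to a nonzero limit. A discrete set of reals is countable, so the
  exceptional times, a finite union of such sets, are countable and hence negligible. At every
  other time \<open>\<parallel>x(t)\<parallel>\<close> has a two-sided derivative, which is then also its upper right Dini
  derivative, and the second identity is the first one multiplied by \<open>\<parallel>x(t)\<parallel>\<close>.
\<close>

text \<open>Every point of the set is the only one of its members in some member of a countable basis,
  and that basic open set identifies the point.\<close>

lemma discrete_imp_countable:
  fixes S :: "'a::second_countable_topology set"
  assumes "discrete S"
  shows "countable S"
proof -
  obtain \<B> :: "'a set set" where \<B>: "countable \<B>" "topological_basis \<B>"
    using ex_countable_basis by blast
  have "\<exists>U\<in>\<B>. U \<inter> S = {t}" if "t \<in> S" for t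
  proof -
    obtain T where T: "open T" "T \<inter> S = {t}"
      using assms \<open>t \<in> S\<close> by (meson discreteD isolated_inE)
    obtain U where "U \<in> \<B>" "t \<in> U" "U \<subseteq> T"
      using topological_basisE[OF \<B>(2) T(1)] T(2) by blast
    then show ?thesis
      using T(2) that by blast
  qed
  then obtain U where U: "\<And>t. t \<in> S \<Longrightarrow> U t \<in> \<B> \<and> U t \<inter> S = {t}"
    by metis
  then have "inj_on U S"
    by (metis inj_onI singleton_inject)
  moreover have "countable (U ` S)"
    using U \<B>(1) by (meson countable_subset image_subsetI)
  ultimately show ?thesis
    using countable_image_inj_on by blast
qed

definition transversal_zeros :: "(real \<Rightarrow> real) \<Rightarrow> real set" where
  "transversal_zeros f = {t. f t = 0 \<and> (\<exists>D. D \<noteq> 0 \<and> (f has_real_derivative D) (at t))}"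

text \<open>If \<open>f t = 0\<close> and \<open>f' t \<noteq> 0\<close>, the difference quotients \<open>f s / (s - t)\<close> are nonzero for
  \<open>s\<close> near \<open>t\<close>, so \<open>t\<close> has no other zero of \<open>f\<close> nearby.\<close>

lemma discrete_transversal_zeros: "discrete (transversal_zeros f)"
  unfolding discrete_altdef
proof
  fix t assume "t \<in> transversal_zeros f"
  then obtain D where "f t = 0" "D \<noteq> 0" "(f has_real_derivative D) (at t)"
    by (auto simp: transversal_zeros_def)
  then have "((\<lambda>s. f s / (s - t)) \<longlongrightarrow> D) (at t)"
    by (simp add: has_field_derivative_iff)
  then have "\<forall>\<^sub>F s in at t. f s / (s - t) \<noteq> 0"
    using \<open>D \<noteq> 0\<close> by (rule tendsto_imp_eventually_ne)
  then show "\<forall>\<^sub>F s in at t. s \<notin> transversal_zeros f"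
    by eventually_elim (auto simp: transversal_zeros_def)
qed

lemma has_real_derivative_abs:
  fixes f :: "real \<Rightarrow> real"
  assumes f: "(f has_real_derivative D) (at t)" and t: "t \<notin> transversal_zeros f"
  shows "((\<lambda>s. \<bar>f s\<bar>) has_real_derivative sgn (f t) * D) (at t)"
proof (cases "f t = 0")
  case False
  have "(abs has_real_derivative sgn (f t)) (at (f t))"
    using GDERIV_norm[OF False] by (simp add: gderiv_def has_field_derivative_def mult.commute)
  from DERIV_chain2[OF this f] show ?thesis .
next
  case True
  with f t have "D = 0"
    by (auto simp: transversal_zeros_def)
  with f True have "((\<lambda>s. f s / (s - t)) \<longlongrightarrow> 0) (at t)"
    by (simp add: has_field_derivative_iff)
  \<comment> \<open>At a zero the difference quotients of \<open>\<bar>f\<bar>\<close> and \<open>f\<close> have the same absolute values.\<close>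
  then have "((\<lambda>s. \<bar>f s\<bar> / (s - t)) \<longlongrightarrow> 0) (at t)"
    by (subst tendsto_rabs_zero_iff[symmetric])
      (auto simp: abs_divide dest: tendsto_rabs_zero)
  with True show ?thesis
    by (simp add: has_field_derivative_iff)
qed

lemma upper_right_dini_eq_derivative:
  assumes "(f has_real_derivative D) (at t)"
  shows "upper_right_dini f t = ereal D"
proof -
  have "((\<lambda>h. (f (t + h) - f t) / h) \<longlongrightarrow> D) (at_right 0)"
    using assms unfolding DERIV_def by (rule filterlim_mono) (auto simp: at_le)
  then show ?thesis
    unfolding upper_right_dini_def by (intro lim_imp_Limsup) (auto simp: tendsto_ereal)
qed

lemma has_vector_derivative_matrix_vector_mult:
  fixes R :: "real ^ 'n ^ 'm"
  assumes "(x has_vector_derivative x') F"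
  shows "((\<lambda>s. R *v x s) has_vector_derivative R *v x') F"
  using bounded_linear.has_vector_derivative[OF matrix_vector_mul_bounded_linear assms] .

lemma upper_right_dini_weighted_l1_norm:
  fixes R :: "real ^ 'n ^ 'n"
  assumes x: "(x has_vector_derivative x') (at t)"
    and t: "\<And>i. t \<notin> transversal_zeros (\<lambda>s. (R *v x s) $ i)"
  shows "upper_right_dini (\<lambda>s. weighted_l1_norm R (x s)) t
           = ereal (sign_vec (R *v x t) \<bullet> (R *v x'))"
proof -
  have "((\<lambda>s. (R *v x s) $ i) has_real_derivative (R *v x') $ i) (at t)" for i
    using bounded_linear.has_vector_derivative[OF bounded_linear_vec_nth
        has_vector_derivative_matrix_vector_mult[OF x]]
    by (simp add: has_real_derivative_iff_has_vector_derivative)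
  then have "((\<lambda>s. \<bar>(R *v x s) $ i\<bar>) has_real_derivative sgn ((R *v x t) $ i) * (R *v x') $ i) (at t)"
    for i
    using has_real_derivative_abs t by blast
  then have "((\<lambda>s. weighted_l1_norm R (x s)) has_real_derivative
      (\<Sum>i\<in>UNIV. sgn ((R *v x t) $ i) * (R *v x') $ i)) (at t)"
    unfolding weighted_l1_norm_def l1_norm_def by (intro DERIV_sum)
  then show ?thesis
    by (simp add: upper_right_dini_eq_derivative sign_vec_def inner_vec_def)
qed

theorem theorem21:
  fixes R :: "real ^ 'n ^ 'n" and x :: "real \<Rightarrow> real ^ 'n" and a b :: real
  assumes "invertible R"
    and "x differentiable_on {a<..<b}"
  shows "(AE t\<in>{a<..<b} in lebesgue.
            upper_right_dini (\<lambda>s. weighted_l1_norm R (x s)) t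
              = ereal (sign_vec (R *v x t) \<bullet> (R *v vector_derivative x (at t))))
       \<and> (AE t\<in>{a<..<b} in lebesgue.
            ereal (weighted_l1_norm R (x t)) * upper_right_dini (\<lambda>s. weighted_l1_norm R (x s)) t
              = ereal (sign_pairing R (vector_derivative x (at t)) (x t)))"
proof -
  define N where "N = (\<Union>i. transversal_zeros (\<lambda>s. (R *v x s) $ i))"
  have "countable N"
    unfolding N_def by (intro countable_UN discrete_imp_countable discrete_transversal_zeros) simp
  then have "AE t in lebesgue. t \<notin> N"
    by (intro AE_completion AE_not_in countable_imp_null_set_lborel)
  moreover have dini: "upper_right_dini (\<lambda>s. weighted_l1_norm R (x s)) t
      = ereal (sign_vec (R *v x t) \<bullet> (R *v vector_derivative x (at t)))"
    if "t \<notin> N" "t \<in> {a<..<b}" for t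
  proof (rule upper_right_dini_weighted_l1_norm)
    have "x differentiable at t"
      using assms(2) that(2) by (simp add: differentiable_on_eq_differentiable_at)
    then show "(x has_vector_derivative vector_derivative x (at t)) (at t)"
      by (simp add: vector_derivative_works)
    show "t \<notin> transversal_zeros (\<lambda>s. (R *v x s) $ i)" for i
      using that(1) by (auto simp: N_def)
  qed
  ultimately have
    "AE t\<in>{a<..<b} in lebesgue. upper_right_dini (\<lambda>s. weighted_l1_norm R (x s)) t
      = ereal (sign_vec (R *v x t) \<bullet> (R *v vector_derivative x (at t)))"
    by auto
  moreover from this have
    "AE t\<in>{a<..<b} in lebesgue.
      ereal (weighted_l1_norm R (x t)) * upper_right_dini (\<lambda>s. weighted_l1_norm R (x s)) t
        = ereal (sign_pairing R (vector_derivative x (at t)) (x t))"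
    by eventually_elim (simp add: sign_pairing_def)
  ultimately show ?thesis
    by blast
qed

end
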